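(* Consider a uniform association scheme with Bose–Mesner algebra $\mathcal A$, and let $\mathcal B=\langle A_i: i\in\mathcal I\rangle$ and $\mathcal D=\langle A_i: i\notin\mathcal I\rangle$. Let $F_0,\dots,F_e\in\mathcal B$ be a complete set of primitive idempotents of $\mathcal B$, ordered such that $F_0,\dots,F_{\ell-1}$ are not primitive idempotents of $\mathcal A$ and $F_\ell,\dots,F_e$ are primitive idempotents of $\mathcal A$. Then for each $j=0,\dots,\ell-1$ there exists a matrix $D_j\in\mathcal D$ such that for each union $Y$ of $w'\ge2$ fibres, the matrices $\frac1{w'}(F_j^Y+D_j^Y)$ and $F_j^Y-\frac1{w'}(F_j^Y+D_j^Y)$, $j=0,\dots,\ell-1$, together with $F_\ell^Y,\dots,F_e^Y$, are the primitive idempotents of $\mathcal A^Y$.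
   Context: Symmetric association scheme on $X$: partition $\{R_0,\dots,R_d\}$ of $X\times X$, $R_0$ diagonal, all symmetric, constant intersection numbers; adjacency matrices $A_i$; Bose–Mesner algebra $\mathcal A=\langle A_0,\dots,A_d\rangle$. Imprimitivity system: index set $\mathcal I$, $\{0\}\subsetneq\mathcal I\subsetneq\{0,\dots,d\}$, with $\bigcup_{i\in\mathcal I}R_i$ an equivalence relation whose $w$ classes (fibres) have equal size. For a fibre pair $U,V$, $\mathcal I(U,V)=\{i:R_i\cap(U\times V)\ne\emptyset\}$. For $Y\subseteq X$ let $I^Y$ be the diagonal $0/1$ matrix with $(I^Y)_{xx}=1$ iff $x\in Y$, $M^{YZ}=I^YMI^Z$, $M^Y=M^{YY}$, and $\mathcal A^Y=\{A^Y:A\in\mathcal A\}$. Uniform: $\mathcal I(U,V)=\{0,\dots,d\}\setminus\mathcal I$ for distinct fibres $U,V$, and there are integers $a^h_{ij}$ with $A_i^{UV}A_j^{VW}=\sum_ha^h_{ij}A_h^{UW}$ for all fibres $U,V,W$, $i\in\mathcal I(U,V)$, $j\in\mathcal I(V,W)$. A nonzero idempotent $E$ of a commutative algebra $\mathcal M$ is primitive if $AE$ is a scalar multiple of $E$ for every $A\in\mathcal M$. *)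

theory Defs
  imports "HOL-Analysis.Analysis"
begin

text \<open>The point set of a scheme is the (finite, nonempty) type \<open>'x\<close>; matrices indexed by it are
  elements of \<open>real^'x^'x\<close>, and \<open>span\<close> is the real linear span.\<close>

definition symmetric_association_scheme :: "nat \<Rightarrow> (nat \<Rightarrow> ('x::finite \<times> 'x) set) \<Rightarrow> bool" where
  "symmetric_association_scheme d R \<longleftrightarrow>
     (\<forall>i\<le>d. R i \<noteq> {}) \<and>
     disjoint_family_on R {..d} \<and>
     (\<Union>i\<le>d. R i) = UNIV \<and>
     R 0 = Id \<and>
     (\<forall>i\<le>d. sym (R i)) \<and>
     (\<exists>p :: nat \<Rightarrow> nat \<Rightarrow> nat \<Rightarrow> nat. \<forall>h\<le>d. \<forall>i\<le>d. \<forall>j\<le>d. \<forall>(x, y) \<in> R h.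
        card {z. (x, z) \<in> R i \<and> (z, y) \<in> R j} = p h i j)"

definition adjacency_matrix :: "('x::finite \<times> 'x) set \<Rightarrow> real^'x^'x" where
  "adjacency_matrix S = (\<chi> x y. if (x, y) \<in> S then 1 else 0)"

definition adjacency_span :: "(nat \<Rightarrow> ('x::finite \<times> 'x) set) \<Rightarrow> nat set \<Rightarrow> (real^'x^'x) set" where
  "adjacency_span R J = span ((\<lambda>i. adjacency_matrix (R i)) ` J)"

definition bose_mesner_algebra :: "nat \<Rightarrow> (nat \<Rightarrow> ('x::finite \<times> 'x) set) \<Rightarrow> (real^'x^'x) set" where
  "bose_mesner_algebra d R = adjacency_span R {..d}"

definition fibres :: "(nat \<Rightarrow> ('x::finite \<times> 'x) set) \<Rightarrow> nat set \<Rightarrow> 'x set set" where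
  "fibres R I = UNIV // (\<Union>i\<in>I. R i)"

definition imprimitivity_system :: "nat \<Rightarrow> (nat \<Rightarrow> ('x::finite \<times> 'x) set) \<Rightarrow> nat set \<Rightarrow> bool" where
  "imprimitivity_system d R I \<longleftrightarrow>
     {0} \<subset> I \<and> I \<subset> {..d} \<and>
     equiv UNIV (\<Union>i\<in>I. R i) \<and>
     (\<forall>U\<in>fibres R I. \<forall>V\<in>fibres R I. card U = card V)"

definition index_set :: "nat \<Rightarrow> (nat \<Rightarrow> ('x::finite \<times> 'x) set) \<Rightarrow> 'x set \<Rightarrow> 'x set \<Rightarrow> nat set" where
  "index_set d R U V = {i. i \<le> d \<and> R i \<inter> (U \<times> V) \<noteq> {}}"

definition diag_indicator :: "'x::finite set \<Rightarrow> real^'x^'x" where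
  "diag_indicator Y = (\<chi> x y. if x = y \<and> x \<in> Y then 1 else 0)"

definition block :: "'x::finite set \<Rightarrow> 'x set \<Rightarrow> real^'x^'x \<Rightarrow> real^'x^'x" where
  "block Y Z M = diag_indicator Y ** M ** diag_indicator Z"

abbreviation restrict_to :: "'x::finite set \<Rightarrow> real^'x^'x \<Rightarrow> real^'x^'x" where
  "restrict_to Y M \<equiv> block Y Y M"

definition uniform_scheme :: "nat \<Rightarrow> (nat \<Rightarrow> ('x::finite \<times> 'x) set) \<Rightarrow> nat set \<Rightarrow> bool" where
  "uniform_scheme d R I \<longleftrightarrow>
     symmetric_association_scheme d R \<and>
     imprimitivity_system d R I \<and>
     (\<forall>U\<in>fibres R I. \<forall>V\<in>fibres R I. U \<noteq> V \<longrightarrow> index_set d R U V = {..d} - I) \<and>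
     (\<exists>a :: nat \<Rightarrow> nat \<Rightarrow> nat \<Rightarrow> int.
        \<forall>U\<in>fibres R I. \<forall>V\<in>fibres R I. \<forall>W\<in>fibres R I.
        \<forall>i\<in>index_set d R U V. \<forall>j\<in>index_set d R V W.
          block U V (adjacency_matrix (R i)) ** block V W (adjacency_matrix (R j)) =
          (\<Sum>h\<le>d. of_int (a h i j) *\<^sub>R block U W (adjacency_matrix (R h))))"

definition primitive_idempotent :: "(real^'x^'x::finite) set \<Rightarrow> real^'x^'x \<Rightarrow> bool" where
  "primitive_idempotent M E \<longleftrightarrow>
     E \<in> M \<and> E \<noteq> 0 \<and> E ** E = E \<and> (\<forall>A\<in>M. \<exists>c::real. A ** E = c *\<^sub>R E)"

end

theory Submission
  imports Defs
begin

text \<open>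
  A primitive idempotent \<open>F\<close> of \<open>\<B>\<close> is block diagonal, so for \<open>C, C'\<close> in \<open>F ** \<D>\<close> uniformity
  makes each product \<open>block U V C ** block V U C'\<close> the same multiple of \<open>block U U F\<close>. Hence
  \<open>F ** \<D>\<close> is at most one-dimensional, and it vanishes exactly when \<open>F\<close> stays primitive in \<open>\<A>\<close>.
  Otherwise it is spanned by some \<open>D\<close> which, after rescaling, satisfies
  \<open>block U V D ** block V U D = block U U F\<close> and, for distinct \<open>U, V, W\<close>,
  \<open>block U V D ** block V W D = g *\<^sub>R block U W D\<close> with \<open>g\<^sup>2 = 1\<close>; replacing \<open>D\<close> by \<open>g *\<^sub>R D\<close> removes
  the sign. Then \<open>M = F + D\<close> satisfies \<open>M ** diag_indicator V ** M = M\<close> for every fibre \<open>V\<close>, so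
  the square of \<open>restrict_to Y M\<close> is \<open>w'\<close> times itself. The list is complete because the
  idempotents in it sum to the identity of \<open>restrict_to Y ` \<A>\<close>.
\<close>

section \<open>Bilinearity of the matrix product\<close>

lemma bounded_bilinear_matrix_mult:
  "bounded_bilinear ((**) :: real^'k::finite^'n::finite \<Rightarrow> real^'m::finite^'k \<Rightarrow> real^'m^'n)"
  unfolding bilinear_conv_bounded_bilinear[symmetric] bilinear_def
  by (auto intro!: linearI
      simp: matrix_matrix_mult_def vec_eq_iff algebra_simps sum.distrib sum_distrib_left)

text \<open>Provides sums, differences and scalars on either side of a product as rules named
  \<open>matrix_mult.add_left\<close>, \<open>matrix_mult.sum_right\<close> and so on.\<close>

interpretation matrix_mult: bounded_bilinear
  "(**) :: real^'k::finite^'n::finite \<Rightarrow> real^'m::finite^'k \<Rightarrow> real^'m^'n"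
  by (rule bounded_bilinear_matrix_mult)

subsection \<open>Primitive idempotents of algebras of symmetric matrices\<close>

text \<open>The inner product on matrices is the sum of entrywise products, so reordering the triple
  sum moves \<open>A\<close> across. Left multiplication by a symmetric matrix is thus a
  self-adjoint operator on the matrix space, and spectral arguments apply to ideals.\<close>

lemma inner_matrix_mult_symmetric:
  fixes A M N :: "real^'n::finite^'n"
  assumes "transpose A = A"
  shows "inner (A ** M) N = inner M (A ** N)"
proof -
  have A: "A $ i $ j = A $ j $ i" for i j
    using assms by (metis transpose_def vec_lambda_beta)
  have "inner (A ** M) N = (\<Sum>i\<in>UNIV. \<Sum>j\<in>UNIV. \<Sum>k\<in>UNIV. A $ i $ k * M $ k $ j * N $ i $ j)"
    by (simp add: inner_vec_def matrix_matrix_mult_def sum_distrib_right)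
  also have "\<dots> = (\<Sum>i\<in>UNIV. \<Sum>k\<in>UNIV. \<Sum>j\<in>UNIV. A $ i $ k * M $ k $ j * N $ i $ j)"
    by (intro sum.cong refl sum.swap)
  also have "\<dots> = (\<Sum>k\<in>UNIV. \<Sum>i\<in>UNIV. \<Sum>j\<in>UNIV. A $ i $ k * M $ k $ j * N $ i $ j)"
    by (rule sum.swap)
  also have "\<dots> = (\<Sum>k\<in>UNIV. \<Sum>j\<in>UNIV. \<Sum>i\<in>UNIV. A $ i $ k * M $ k $ j * N $ i $ j)"
    by (intro sum.cong refl sum.swap)
  also have "\<dots> = inner M (A ** N)"
    by (simp add: inner_vec_def matrix_matrix_mult_def sum_distrib_left mult_ac A)
  finally show ?thesis .
qed

text \<open>The inner product of \<open>N ** N\<close> with \<open>mat 1\<close> is the squared norm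
  of \<open>N\<close>.\<close>

lemma symmetric_square_nonzero:
  fixes N :: "real^'n::finite^'n"
  assumes "transpose N = N" "N \<noteq> 0"
  shows "N ** N \<noteq> 0"
proof
  assume "N ** N = 0"
  then have "inner (N ** N) (mat 1) = 0"
    by simp
  then show False
    using assms inner_matrix_mult_symmetric[of N N "mat 1"] by simp
qed

text \<open>The eigenvector is a maximiser of the Rayleigh quotient on the unit sphere of the subspace.\<close>

lemma self_adjoint_eigenvector_in_subspace:
  fixes f :: "'a::euclidean_space \<Rightarrow> 'a"
  assumes f: "linear f" and S: "subspace S" "S \<noteq> {0}"
    and inv: "\<And>x. x \<in> S \<Longrightarrow> f x \<in> S"
    and sa: "\<And>x y. x \<in> S \<Longrightarrow> y \<in> S \<Longrightarrow> inner (f x) y = inner x (f y)"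
  obtains x c where "x \<in> S" "x \<noteq> 0" "f x = c *\<^sub>R x"
proof -
  let ?K = "S \<inter> sphere 0 1"
  have "0 \<in> S" using S(1) by (rule subspace_0)
  then obtain s where s: "s \<in> S" "s \<noteq> 0" using S(2) by auto
  then have "(1 / norm s) *\<^sub>R s \<in> ?K"
    using S(1) by (auto intro: subspace_scale)
  then have "?K \<noteq> {}" by blast
  moreover have "compact ?K"
    using S(1) by (metis closed_subspace compact_sphere closed_Int_compact)
  moreover have "continuous_on ?K (\<lambda>x. inner (f x) x)"
    by (intro continuous_intros linear_continuous_on linear_conv_bounded_linear[THEN iffD1] f)
  ultimately obtain x where x: "x \<in> ?K" and max: "\<And>y. y \<in> ?K \<Longrightarrow> inner (f y) y \<le> inner (f x) x"
    using continuous_attains_sup[of ?K "\<lambda>x. inner (f x) x"] by blast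
  define c where "c = inner (f x) x"
  have xS: "x \<in> S" and x1: "norm x = 1" using x by auto
  have xx: "inner x x = 1" using x1 by (simp add: norm_eq_1)
  \<comment> \<open>Homogeneity extends the bound from the unit sphere to all of
    \<open>S\<close>.\<close>
  have quad: "inner (f y) y \<le> c * inner y y" if "y \<in> S" for y
  proof (cases "y = 0")
    case True
    then show ?thesis using f by (simp add: linear_0)
  next
    case False
    have "(1 / norm y) *\<^sub>R y \<in> ?K" using False that S(1) by (auto intro: subspace_scale)
    from max[OF this] have "inner (f y) y / (norm y)\<^sup>2 \<le> c"
      using f by (simp add: c_def linear_scale power2_eq_square)
    then show ?thesis using False
      by (simp add: divide_le_eq power2_norm_eq_inner)
  qed
  \<comment> \<open>The residual of the eigenvector equation, to be shown zero.\<close>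
  define y where "y = f x - c *\<^sub>R x"
  have yS: "y \<in> S" unfolding y_def using xS inv S(1)
    by (simp add: subspace_diff subspace_scale)
  \<comment> \<open>First variation at the maximiser: \<open>quad\<close> is applied to
    \<open>x + t *\<^sub>R y\<close>, and the term linear in \<open>t\<close> is
    \<open>2 * t * inner y y\<close>.\<close>
  have ty: "2 * t * inner y y \<le> t\<^sup>2 * (c * inner y y - inner (f y) y)" for t :: real
  proof -
    have "x + t *\<^sub>R y \<in> S" using xS yS S(1) by (simp add: subspace_add subspace_scale)
    from quad[OF this]
    have "inner (f x + t *\<^sub>R f y) (x + t *\<^sub>R y) \<le> c * inner (x + t *\<^sub>R y) (x + t *\<^sub>R y)"
      using f by (simp add: linear_add linear_scale)
    then have *: "c + t * inner (f x) y + t * inner (f y) x + t\<^sup>2 * inner (f y) y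
        \<le> c * (1 + 2 * t * inner x y + t\<^sup>2 * inner y y)"
      by (simp add: inner_add_left inner_add_right c_def[symmetric] xx algebra_simps
          power2_eq_square inner_commute[of y x])
    have 1: "inner (f y) x = inner (f x) y"
      using sa[OF yS xS] by (simp add: inner_commute)
    have "inner (f x) y = inner y y + c * inner x y"
      by (simp add: y_def inner_diff_left algebra_simps inner_diff_right inner_commute)
    then show ?thesis using * unfolding 1 by (simp add: algebra_simps)
  qed
  have "inner y y = 0"
  proof (rule ccontr)
    assume "inner y y \<noteq> 0"
    then have pos: "inner y y > 0" by simp
    let ?K = "c * inner y y - inner (f y) y"
    have "?K \<ge> 0" using quad[OF yS] by simp
    \<comment> \<open>Small enough that the quadratic term cannot compensate the linear one; the
      added 1 keeps the denominator positive when \<open>?K\<close> is zero.\<close>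
    define t where "t = inner y y / (?K + 1)"
    have t: "t > 0" unfolding t_def using pos \<open>?K \<ge> 0\<close> by simp
    have "2 * inner y y \<le> t * ?K"
      using ty[of t] t by (simp add: power2_eq_square mult.assoc)
    also have "\<dots> \<le> t * (?K + 1)" using t by simp
    also have "\<dots> = inner y y" unfolding t_def using \<open>?K \<ge> 0\<close> by simp
    finally show False using pos by simp
  qed
  then have "f x = c *\<^sub>R x" unfolding y_def by simp
  moreover have "x \<noteq> 0" using x1 by auto
  ultimately show ?thesis using that xS by blast
qed

text \<open>Transposition reverses a product, and here it fixes both factors and the
  product.\<close>

lemma symmetric_algebra_commute:
  fixes M N :: "real^'n::finite^'n"
  assumes "\<And>M. M \<in> B \<Longrightarrow> transpose M = M"
    and "M \<in> B" "N \<in> B" "M ** N \<in> B"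
  shows "M ** N = N ** M"
  using assms by (metis matrix_transpose_mul)

text \<open>On an ideal of minimal dimension every element of the algebra acts as a scalar, since each
  of its eigenspaces in the ideal is again an ideal.\<close>

lemma ideal_contains_primitive_idempotent:
  fixes B J :: "(real^'n::finite^'n) set"
  assumes B: "\<And>M. M \<in> B \<Longrightarrow> transpose M = M"
    and mult: "\<And>M N. M \<in> B \<Longrightarrow> N \<in> B \<Longrightarrow> M ** N \<in> B"
    and J: "subspace J" "J \<subseteq> B" "J \<noteq> {0}"
    and ideal: "\<And>M N. M \<in> B \<Longrightarrow> N \<in> J \<Longrightarrow> M ** N \<in> J"
  obtains E where "E \<in> J" "primitive_idempotent B E"
proof -
  \<comment> \<open>\<open>P\<close> singles out the nonzero ideals contained in
    \<open>J\<close>.\<close>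
  define P where "P K \<longleftrightarrow> subspace K \<and> K \<subseteq> J \<and> K \<noteq> {0} \<and> (\<forall>M\<in>B. \<forall>N\<in>K. M ** N \<in> K)" for K
  have "P J" using J ideal by (simp add: P_def)
  then obtain K where K: "P K" and min: "\<And>K'. P K' \<Longrightarrow> dim K \<le> dim K'"
    by (metis arg_min_natI arg_min_nat_le)
  have KB: "K \<subseteq> B" using K J(2) by (auto simp: P_def)
  have subK: "subspace K" using K by (simp add: P_def)
  have scalar: "\<exists>c. \<forall>N\<in>K. M ** N = c *\<^sub>R N" if M: "M \<in> B" for M
  proof -
    have "linear (\<lambda>N. M ** N)"
      by (intro bounded_linear.linear matrix_mult.bounded_linear_right)
    then obtain N c where N: "N \<in> K" "N \<noteq> 0" "M ** N = c *\<^sub>R N"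
      by (rule self_adjoint_eigenvector_in_subspace[of "\<lambda>N. M ** N" K])
        (use K M in \<open>simp_all add: P_def inner_matrix_mult_symmetric[OF B[OF M]]\<close>)
    define K' where "K' = {N \<in> K. M ** N = c *\<^sub>R N}"
    have "P K'"
    proof -
      have "subspace K'"
        using subK
        by (auto simp: K'_def subspace_def matrix_mult.add_right matrix_mult.scaleR_right
            algebra_simps)
      moreover have "L ** N \<in> K'" if L: "L \<in> B" and N: "N \<in> K'" for L N
      proof -
        have "M ** (L ** N) = L ** (M ** N)"
          using symmetric_algebra_commute[OF B M L mult[OF M L]] by (simp add: matrix_mul_assoc)
        then show ?thesis using L N K by (simp add: K'_def P_def matrix_mult.scaleR_right)
      qed
      moreover have "K' \<noteq> {0}" using N by (auto simp: K'_def)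
      ultimately show ?thesis using K by (auto simp: P_def K'_def)
    qed
    then have "K' = K"
      using min[of K'] subK by (intro subspace_dim_equal) (auto simp: K'_def P_def)
    then show ?thesis by (auto simp: K'_def)
  qed
  obtain N where N: "N \<in> K" "N \<noteq> 0" using K subspace_0[OF subK] by (auto simp: P_def)
  \<comment> \<open>\<open>N\<close> itself acts on the ideal as a scalar, nonzero because
    \<open>N ** N\<close> is nonzero; dividing by it makes \<open>N\<close> idempotent.\<close>
  obtain c where c: "N ** N = c *\<^sub>R N" using scalar N KB by blast
  have "c \<noteq> 0" using symmetric_square_nonzero[of N] B N KB c by auto
  define E where "E = (1 / c) *\<^sub>R N"
  have EK: "E \<in> K" unfolding E_def using N subK by (simp add: subspace_scale)
  have "E ** E = E"
    using c \<open>c \<noteq> 0\<close> by (simp add: E_def matrix_mult.scaleR_left matrix_mult.scaleR_right)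
  moreover have "E \<noteq> 0" using N \<open>c \<noteq> 0\<close> by (simp add: E_def)
  ultimately have "primitive_idempotent B E"
    using EK KB scalar unfolding primitive_idempotent_def by blast
  then show ?thesis using that EK K by (auto simp: P_def)
qed

text \<open>The product is a multiple of \<open>P\<close> and, after transposing, also of
  \<open>E\<close>. If it were nonzero, \<open>E\<close> and \<open>P\<close> would be proportional,
  and proportional nonzero idempotents coincide.\<close>

lemma primitive_idempotents_orthogonal:
  fixes E P :: "real^'n::finite^'n"
  assumes M: "\<And>A. A \<in> M \<Longrightarrow> transpose A = A"
    and E: "primitive_idempotent M E" and P: "primitive_idempotent M P" and "E \<noteq> P"
  shows "E ** P = 0"
proof -
  have EM: "E \<in> M" "P \<in> M" "E ** E = E" "P ** P = P" "E \<noteq> 0" "P \<noteq> 0"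
    using E P by (auto simp: primitive_idempotent_def)
  obtain a where a: "E ** P = a *\<^sub>R P"
    using P EM by (auto simp: primitive_idempotent_def)
  obtain b where b: "P ** E = b *\<^sub>R E"
    using E EM by (auto simp: primitive_idempotent_def)
  have "E ** P = transpose (P ** E)"
    using EM M by (simp add: matrix_transpose_mul)
  also have "\<dots> = b *\<^sub>R E"
    using EM M by (simp add: b transpose_scalar)
  finally have ab: "a *\<^sub>R P = b *\<^sub>R E" using a by simp
  show ?thesis
  proof (cases "b = 0")
    case True
    then show ?thesis using a ab by simp
  next
    case False
    then have Ek: "E = (a / b) *\<^sub>R P"
      using arg_cong[OF ab, of "\<lambda>X. (1 / b) *\<^sub>R X"] by simp
    have "(a / b) *\<^sub>R E = E ** E"
      unfolding Ek by (simp add: matrix_mult.scaleR_left matrix_mult.scaleR_right EM(4))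
    then have "(a / b) *\<^sub>R E = E" using EM(3) by simp
    then have "a / b = 1" using EM(5) by (metis scaleR_cancel_right scaleR_one)
    then show ?thesis using Ek \<open>E \<noteq> P\<close> by simp
  qed
qed

text \<open>The common annihilator of all primitive idempotents is an ideal. If nonzero, it would
  contain a primitive idempotent, which does not annihilate itself. By orthogonality it contains
  \<open>mat 1 - \<Sum>T\<close>.\<close>

lemma sum_primitive_idempotents:
  fixes B :: "(real^'n::finite^'n) set"
  assumes B: "\<And>M. M \<in> B \<Longrightarrow> transpose M = M"
    and mult: "\<And>M N. M \<in> B \<Longrightarrow> N \<in> B \<Longrightarrow> M ** N \<in> B"
    and sub: "subspace B" and one: "mat 1 \<in> B"
    and fin: "finite T" and T: "T = {E. primitive_idempotent B E}"
  shows "\<Sum>T = mat 1"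
proof -
  define J where "J = {N \<in> B. \<forall>E\<in>T. E ** N = 0}"
  have TB: "T \<subseteq> B" unfolding T by (auto simp: primitive_idempotent_def)
  have subJ: "subspace J" using sub
    by (auto simp: J_def subspace_def matrix_mult.add_right matrix_mult.scaleR_right
        matrix_mult.zero_right)
  have idealJ: "M ** N \<in> J" if M: "M \<in> B" and N: "N \<in> J" for M N
  proof -
    have "E ** (M ** N) = M ** (E ** N)" if "E \<in> T" for E
    proof -
      have "E ** M = M ** E"
        using TB that by (intro symmetric_algebra_commute[OF B _ M mult[OF _ M]]) auto
      then show ?thesis by (simp add: matrix_mul_assoc)
    qed
    then show ?thesis using M N mult by (simp add: J_def matrix_mult.zero_right)
  qed
  have "J = {0}"
  proof (rule ccontr)
    assume "J \<noteq> {0}"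
    moreover have "J \<subseteq> B" by (auto simp: J_def)
    ultimately obtain E where "E \<in> J" "primitive_idempotent B E"
      using ideal_contains_primitive_idempotent[OF B mult subJ _ _ idealJ] by auto
    then show False unfolding J_def T primitive_idempotent_def by auto
  qed
  moreover have "mat 1 - \<Sum>T \<in> J"
  proof -
    have "E ** \<Sum>T = E" if "E \<in> T" for E
    proof -
      have "E ** \<Sum>T = (\<Sum>P\<in>T. if P = E then E else 0)"
        unfolding matrix_mult.sum_right
      proof (rule sum.cong)
        fix P assume "P \<in> T"
        then show "E ** P = (if P = E then E else 0)"
          using primitive_idempotents_orthogonal[of B E P] B that
          unfolding T by (auto simp: primitive_idempotent_def)
      qed simp
      then show ?thesis using fin that by simp
    qed
    then show ?thesis using one sub TB
      by (auto simp: J_def matrix_mult.diff_right intro!: subspace_diff subspace_sum)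
  qed
  ultimately show ?thesis by simp
qed

subsection \<open>Blocks and the Bose--Mesner algebra\<close>

lemma diag_indicator_mult_nth:
  fixes M :: "real^'x::finite^'x"
  shows "(diag_indicator Y ** M) $ x $ y = (if x \<in> Y then M $ x $ y else 0)"
proof -
  have "diag_indicator Y $ x $ u * M $ u $ y = (if u = x then if x \<in> Y then M $ u $ y else 0 else 0)"
    for u by (simp add: diag_indicator_def)
  then show ?thesis by (simp add: matrix_matrix_mult_def)
qed

lemma mult_diag_indicator_nth:
  fixes M :: "real^'x::finite^'x"
  shows "(M ** diag_indicator Y) $ x $ y = (if y \<in> Y then M $ x $ y else 0)"
proof -
  have "M $ x $ u * diag_indicator Y $ u $ y = (if u = y then if y \<in> Y then M $ x $ u else 0 else 0)"
    for u by (simp add: diag_indicator_def)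
  then show ?thesis by (simp add: matrix_matrix_mult_def)
qed

lemma block_nth: "block Y Z M $ x $ y = (if x \<in> Y \<and> y \<in> Z then M $ x $ y else 0)"
  by (simp add: block_def mult_diag_indicator_nth diag_indicator_mult_nth)

lemma diag_indicator_idem: "diag_indicator Y ** diag_indicator Y = diag_indicator Y"
  by (simp add: vec_eq_iff diag_indicator_mult_nth) (simp add: diag_indicator_def)

lemma block_add: "block Y Z (M + N) = block Y Z M + block Y Z N"
  by (simp add: vec_eq_iff block_nth)

lemma block_diff: "block Y Z (M - N) = block Y Z M - block Y Z N"
  by (simp add: vec_eq_iff block_nth)

lemma block_scaleR: "block Y Z (c *\<^sub>R M) = c *\<^sub>R block Y Z M"
  by (simp add: vec_eq_iff block_nth)

lemma block_zero [simp]: "block Y Z 0 = 0"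
  by (simp add: vec_eq_iff block_nth)

lemma block_sum: "block Y Z (\<Sum>i\<in>S. M i) = (\<Sum>i\<in>S. block Y Z (M i))"
  by (induction S rule: infinite_finite_induct) (simp_all add: block_add)

lemma transpose_block: "transpose (block Y Z M) = block Z Y (transpose M)"
  by (simp add: vec_eq_iff block_nth transpose_def)

lemma block_block_subset:
  "U \<subseteq> Y \<Longrightarrow> V \<subseteq> Z \<Longrightarrow> block U V (block Y Z M) = block U V M"
  by (auto simp: vec_eq_iff block_nth)

text \<open>Turns a product of blocks through \<open>V\<close> into a sandwich of
  \<open>diag_indicator V\<close>, which can then be summed over several fibres.\<close>

lemma block_mult_block:
  "block U V M ** block V W N = block U W (M ** diag_indicator V ** N)"
  unfolding block_def by (metis diag_indicator_idem matrix_mul_assoc)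

section \<open>The scheme and the entrywise description of its matrix spaces\<close>

locale uniform_association_scheme =
  fixes d :: nat and R :: "nat \<Rightarrow> ('x::finite \<times> 'x) set" and I :: "nat set"
  assumes uniform: "uniform_scheme d R I"
begin

abbreviation "\<A> \<equiv> bose_mesner_algebra d R"
abbreviation "\<B> \<equiv> adjacency_span R I"
abbreviation "\<D> \<equiv> adjacency_span R ({..d} - I)"

text \<open>The relations partition all pairs, so each pair has exactly one index. Matrices of the
  algebra become functions of this index.\<close>

definition idx :: "'x \<Rightarrow> 'x \<Rightarrow> nat" where
  "idx x y = (THE i. i \<le> d \<and> (x, y) \<in> R i)"

lemma scheme: "symmetric_association_scheme d R" and imprimitive: "imprimitivity_system d R I"
  using uniform by (auto simp: uniform_scheme_def)

lemma I_subset: "I \<subseteq> {..d}" and zero_in_I: "0 \<in> I"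
  using imprimitive by (auto simp: imprimitivity_system_def)

lemma idx_bound: "idx x y \<le> d" and in_R_iff: "i \<le> d \<Longrightarrow> (x, y) \<in> R i \<longleftrightarrow> idx x y = i"
proof -
  have cover: "(\<Union>i\<le>d. R i) = UNIV" and disj: "disjoint_family_on R {..d}"
    using scheme by (auto simp: symmetric_association_scheme_def)
  have ex: "\<exists>!i. i \<le> d \<and> (x, y) \<in> R i"
  proof -
    have "(x, y) \<in> (\<Union>i\<le>d. R i)" using cover by simp
    then obtain i where "i \<le> d" "(x, y) \<in> R i" by auto
    moreover have "j = i" if "j \<le> d" "(x, y) \<in> R j" for j
      using disj calculation that by (auto simp: disjoint_family_on_def)
    ultimately show ?thesis by blast
  qed
  from theI'[OF ex] show "idx x y \<le> d" by (simp add: idx_def)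
  show "(x, y) \<in> R i \<longleftrightarrow> idx x y = i" if "i \<le> d"
    using theI'[OF ex] ex that unfolding idx_def by blast
qed

lemma idx_sym: "idx y x = idx x y"
proof -
  have "sym (R (idx x y))"
    using scheme idx_bound by (auto simp: symmetric_association_scheme_def)
  then show ?thesis using in_R_iff idx_bound by (metis symD)
qed

lemma idx_self [simp]: "idx x x = 0"
  using scheme in_R_iff[of 0 x x] by (auto simp: symmetric_association_scheme_def)

lemma union_R_iff: "(x, y) \<in> (\<Union>i\<in>I. R i) \<longleftrightarrow> idx x y \<in> I"
proof -
  have "(x, y) \<in> R i \<longleftrightarrow> idx x y = i" if "i \<in> I" for i
    using that I_subset in_R_iff by auto
  then show ?thesis by auto
qed

lemma idx_trans: "idx x y \<in> I \<Longrightarrow> idx y z \<in> I \<Longrightarrow> idx x z \<in> I"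
  using imprimitive union_R_iff unfolding imprimitivity_system_def equiv_def
  by (meson transD)

lemma adjacency_matrix_nth:
  "i \<le> d \<Longrightarrow> adjacency_matrix (R i) $ x $ y = (if idx x y = i then 1 else 0)"
  by (simp add: adjacency_matrix_def in_R_iff)

lemma adjacency_sum_nth:
  assumes "J \<subseteq> {..d}"
  shows "(\<Sum>i\<in>J. c i *\<^sub>R adjacency_matrix (R i)) $ x $ y = (if idx x y \<in> J then c (idx x y) else 0)"
proof -
  have "finite J" using assms finite_subset by blast
  have "(\<Sum>i\<in>J. c i *\<^sub>R adjacency_matrix (R i)) $ x $ y = (\<Sum>i\<in>J. if i = idx x y then c i else 0)"
    using assms by (auto simp: adjacency_matrix_nth intro!: sum.cong)
  then show ?thesis using \<open>finite J\<close> by simp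
qed

lemma adjacency_span_eq:
  assumes "J \<subseteq> {..d}"
  shows "adjacency_span R J = {M. \<exists>c. M = (\<Sum>i\<in>J. c i *\<^sub>R adjacency_matrix (R i))}" (is "_ = ?S")
proof
  have fin: "finite J" using assms finite_subset by blast
  have "subspace ?S"
  proof (rule subspaceI)
    show "0 \<in> ?S" by (auto intro!: exI[of _ "\<lambda>_. 0"])
    show "M + N \<in> ?S" if "M \<in> ?S" "N \<in> ?S" for M N
    proof -
      obtain a b where "M = (\<Sum>i\<in>J. a i *\<^sub>R adjacency_matrix (R i))"
        "N = (\<Sum>i\<in>J. b i *\<^sub>R adjacency_matrix (R i))" using \<open>M \<in> ?S\<close> \<open>N \<in> ?S\<close> by auto
      then show ?thesis
        by (auto intro!: exI[of _ "\<lambda>i. a i + b i"] simp: sum.distrib scaleR_add_left)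
    qed
    show "c *\<^sub>R M \<in> ?S" if "M \<in> ?S" for c M
    proof -
      obtain a where "M = (\<Sum>i\<in>J. a i *\<^sub>R adjacency_matrix (R i))" using \<open>M \<in> ?S\<close> by auto
      then show ?thesis by (auto intro!: exI[of _ "\<lambda>i. c * a i"] simp: scaleR_sum_right)
    qed
  qed
  moreover have "(\<lambda>i. adjacency_matrix (R i)) ` J \<subseteq> ?S"
  proof
    fix M assume "M \<in> (\<lambda>i. adjacency_matrix (R i)) ` J"
    then obtain j where j: "j \<in> J" "M = adjacency_matrix (R j)" by auto
    then have "M = (\<Sum>i\<in>J. (if i = j then 1 else 0) *\<^sub>R adjacency_matrix (R i))"
      using assms by (auto simp: vec_eq_iff adjacency_sum_nth adjacency_matrix_nth subset_iff
          simp del: sum_component)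
    then show "M \<in> ?S" by (intro CollectI exI)
  qed
  ultimately show "adjacency_span R J \<subseteq> ?S"
    unfolding adjacency_span_def by (rule span_minimal[rotated])
  show "?S \<subseteq> adjacency_span R J"
  proof clarify
    fix c
    show "(\<Sum>i\<in>J. c i *\<^sub>R adjacency_matrix (R i)) \<in> adjacency_span R J"
      unfolding adjacency_span_def by (intro span_sum span_scale span_base imageI)
  qed
qed

text \<open>Adjacency matrices of distinct relations have disjoint supports, so the coefficients of
  a combination are its entries.\<close>

lemma adjacency_span_iff:
  assumes "J \<subseteq> {..d}"
  shows "M \<in> adjacency_span R J \<longleftrightarrow>
    (\<exists>c. \<forall>x y. M $ x $ y = (if idx x y \<in> J then c (idx x y) else 0))"
  unfolding adjacency_span_eq[OF assms]
  by (simp add: vec_eq_iff adjacency_sum_nth[OF assms] del: sum_component)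

lemma A_iff: "M \<in> \<A> \<longleftrightarrow> (\<exists>c. \<forall>x y. M $ x $ y = c (idx x y))"
  unfolding bose_mesner_algebra_def adjacency_span_iff[OF order_refl] by (simp add: idx_bound)

lemma adjacency_span_iff_A:
  assumes "J \<subseteq> {..d}"
  shows "M \<in> adjacency_span R J \<longleftrightarrow> M \<in> \<A> \<and> (\<forall>x y. idx x y \<notin> J \<longrightarrow> M $ x $ y = 0)"
    (is "?l \<longleftrightarrow> ?r")
proof
  assume ?l
  then obtain c where "\<forall>x y. M $ x $ y = (if idx x y \<in> J then c (idx x y) else 0)"
    using adjacency_span_iff[OF assms] by blast
  then show ?r unfolding A_iff by (auto intro!: exI[of _ "\<lambda>i. if i \<in> J then c i else 0"])
next
  assume r: ?r
  then obtain c where "\<forall>x y. M $ x $ y = c (idx x y)" using A_iff by blast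
  then have "\<forall>x y. M $ x $ y = (if idx x y \<in> J then c (idx x y) else 0)" using r by auto
  then show ?l using adjacency_span_iff[OF assms] by blast
qed

lemma B_iff: "M \<in> \<B> \<longleftrightarrow> M \<in> \<A> \<and> (\<forall>x y. idx x y \<notin> I \<longrightarrow> M $ x $ y = 0)"
  by (rule adjacency_span_iff_A[OF I_subset])

lemma D_iff: "M \<in> \<D> \<longleftrightarrow> M \<in> \<A> \<and> (\<forall>x y. idx x y \<in> I \<longrightarrow> M $ x $ y = 0)"
  using adjacency_span_iff_A[of "{..d} - I"] by (auto simp: idx_bound)

lemma subspace_A: "subspace \<A>" and subspace_B: "subspace \<B>" and subspace_D: "subspace \<D>"
  by (simp_all add: bose_mesner_algebra_def adjacency_span_def)

lemma B_sub_A: "M \<in> \<B> \<Longrightarrow> M \<in> \<A>" and D_sub_A: "M \<in> \<D> \<Longrightarrow> M \<in> \<A>"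
  by (auto simp: B_iff D_iff)

text \<open>The entries within fibres are separated from those between distinct fibres.\<close>

lemma A_split:
  assumes "M \<in> \<A>"
  obtains M1 M2 where "M1 \<in> \<B>" "M2 \<in> \<D>" "M = M1 + M2"
proof -
  obtain c where c: "\<forall>x y. M $ x $ y = c (idx x y)" using assms A_iff by blast
  let ?M1 = "\<chi> x y. if idx x y \<in> I then c (idx x y) else 0"
  let ?M2 = "\<chi> x y. if idx x y \<in> I then 0 else c (idx x y)"
  have "?M1 \<in> \<B>" unfolding B_iff A_iff by (auto intro: exI[of _ "\<lambda>i. if i \<in> I then c i else 0"])
  moreover have "?M2 \<in> \<D>"
    unfolding D_iff A_iff by (auto intro: exI[of _ "\<lambda>i. if i \<in> I then 0 else c i"])
  moreover have "M = ?M1 + ?M2" using c by (simp add: vec_eq_iff)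
  ultimately show ?thesis using that by blast
qed

lemma A_symmetric: "M \<in> \<A> \<Longrightarrow> transpose M = M"
  by (auto simp: A_iff vec_eq_iff transpose_def idx_sym)

lemma A_entry_sym: "M \<in> \<A> \<Longrightarrow> M $ x $ y = M $ y $ x"
  by (auto simp: A_iff idx_sym)

lemma mat_1_in_B: "mat 1 \<in> \<B>"
proof -
  have "idx x y = 0 \<longleftrightarrow> x = y" for x y
    using scheme in_R_iff[of 0 x y] by (auto simp: symmetric_association_scheme_def)
  then show ?thesis unfolding B_iff A_iff using zero_in_I
    by (auto intro!: exI[of _ "\<lambda>i. if i = 0 then 1 else 0"] simp: mat_def)
qed

lemma intersection_numbers:
  obtains p where "\<And>x y i j. i \<le> d \<Longrightarrow> j \<le> d \<Longrightarrow>
    card {z. idx x z = i \<and> idx z y = j} = p (idx x y) i j"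
proof -
  obtain p where p: "\<forall>h\<le>d. \<forall>i\<le>d. \<forall>j\<le>d. \<forall>(x, y) \<in> R h.
        card {z. (x, z) \<in> R i \<and> (z, y) \<in> R j} = p h i j"
    using scheme unfolding symmetric_association_scheme_def by (elim conjE exE) (rule that)
  have "card {z. idx x z = i \<and> idx z y = j} = p (idx x y) i j" if "i \<le> d" "j \<le> d" for x y i j
  proof -
    have "(x, y) \<in> R (idx x y)" by (simp add: in_R_iff idx_bound)
    then have "card {z. (x, z) \<in> R i \<and> (z, y) \<in> R j} = p (idx x y) i j"
      using p that idx_bound[of x y] by fastforce
    then show ?thesis using that by (simp add: in_R_iff)
  qed
  then show ?thesis using that by blast
qed

lemma A_mult:
  assumes "M \<in> \<A>" "N \<in> \<A>"
  shows "M ** N \<in> \<A>"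
proof -
  obtain p where p: "\<And>x y i j. i \<le> d \<Longrightarrow> j \<le> d \<Longrightarrow>
      card {z. idx x z = i \<and> idx z y = j} = p (idx x y) i j"
    using intersection_numbers by blast
  obtain m n where m: "\<And>x y. M $ x $ y = m (idx x y)" and n: "\<And>x y. N $ x $ y = n (idx x y)"
    using assms A_iff by metis
  have "(M ** N) $ x $ y = (\<Sum>(i, j)\<in>{..d} \<times> {..d}. real (p (idx x y) i j) * (m i * n j))" for x y
  proof -
    have "(M ** N) $ x $ y = (\<Sum>z\<in>UNIV. m (idx x z) * n (idx z y))"
      by (simp add: matrix_matrix_mult_def m n)
    \<comment> \<open>The points \<open>z\<close> are grouped by the pair of indices
      \<open>(idx x z, idx z y)\<close>; the summand is constant on each group, whose size is an
      intersection number.\<close>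
    also have "\<dots> = (\<Sum>q\<in>{..d} \<times> {..d}. \<Sum>z\<in>{z \<in> UNIV. (idx x z, idx z y) = q}.
        m (idx x z) * n (idx z y))"
      by (rule sum.group[symmetric]) (auto simp: idx_bound)
    also have "\<dots> = (\<Sum>(i, j)\<in>{..d} \<times> {..d}. real (p (idx x y) i j) * (m i * n j))"
    proof (rule sum.cong[OF refl], unfold split_paired_all prod.case)
      fix i j assume "(i, j) \<in> {..d} \<times> {..d}"
      then have "card {z. idx x z = i \<and> idx z y = j} = p (idx x y) i j"
        using p by simp
      then show "(\<Sum>z\<in>{z \<in> UNIV. (idx x z, idx z y) = (i, j)}. m (idx x z) * n (idx z y)) =
          real (p (idx x y) i j) * (m i * n j)"
        by simp
    qed
    finally show ?thesis .
  qed
  then show ?thesis unfolding A_iff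
    by (intro exI[of _ "\<lambda>h. \<Sum>(i, j)\<in>{..d} \<times> {..d}. real (p h i j) * (m i * n j)"] allI)
qed

lemma A_commute: "M \<in> \<A> \<Longrightarrow> N \<in> \<A> \<Longrightarrow> M ** N = N ** M"
  using symmetric_algebra_commute[of \<A> M N] A_symmetric A_mult by blast

lemma B_mult:
  assumes "M \<in> \<B>" "N \<in> \<B>"
  shows "M ** N \<in> \<B>"
proof -
  have "M $ x $ z * N $ z $ y = 0" if "idx x y \<notin> I" for x y z
    using that idx_trans[of x z y] assms by (auto simp: B_iff)
  then show ?thesis
    unfolding B_iff[of "M ** N"] using A_mult[of M N] B_sub_A assms
    by (auto simp: matrix_matrix_mult_def intro!: sum.neutral)
qed

text \<open>If \<open>idx x y\<close> and \<open>idx x z\<close> lie in \<open>I\<close>, then so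
  does \<open>idx z y\<close>, where \<open>N\<close> vanishes. Hence \<open>\<D>\<close> is a
  module over \<open>\<B>\<close>.\<close>

lemma B_mult_D:
  assumes "M \<in> \<B>" "N \<in> \<D>"
  shows "M ** N \<in> \<D>"
proof -
  have "M $ x $ z * N $ z $ y = 0" if "idx x y \<in> I" for x y z
    using that idx_trans[of z x y] idx_sym[of z x] assms unfolding B_iff D_iff
    by (cases "idx x z \<in> I") simp_all
  then show ?thesis
    unfolding D_iff[of "M ** N"] using A_mult[of M N] B_sub_A D_sub_A assms
    by (auto simp: matrix_matrix_mult_def intro!: sum.neutral)
qed

subsection \<open>Fibres\<close>

lemma fibre_related:
  assumes "U \<in> fibres R I" "V \<in> fibres R I" "x \<in> U" "y \<in> V"
  shows "idx x y \<in> I \<longleftrightarrow> U = V"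
  using assms imprimitive quotient_eq_iff[of UNIV "\<Union>i\<in>I. R i" U V x y]
  unfolding fibres_def imprimitivity_system_def union_R_iff[symmetric] by blast

lemma fibre_exists: "\<exists>U\<in>fibres R I. x \<in> U"
proof -
  have "equiv UNIV (\<Union>i\<in>I. R i)" using imprimitive by (simp add: imprimitivity_system_def)
  then have "\<Union>(fibres R I) = UNIV" unfolding fibres_def by (rule Union_quotient)
  then show ?thesis by blast
qed

lemma fibre_nonempty: "U \<in> fibres R I \<Longrightarrow> U \<noteq> {}"
  using imprimitive unfolding fibres_def imprimitivity_system_def
  by (metis in_quotient_imp_non_empty)

lemma fibre_disjoint: "U \<in> fibres R I \<Longrightarrow> V \<in> fibres R I \<Longrightarrow> x \<in> U \<Longrightarrow> x \<in> V \<Longrightarrow> U = V"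
  using fibre_related[of U V x x] zero_in_I by simp

lemma block_B_off_diagonal:
  "M \<in> \<B> \<Longrightarrow> U \<in> fibres R I \<Longrightarrow> V \<in> fibres R I \<Longrightarrow> U \<noteq> V \<Longrightarrow> block U V M = 0"
  using fibre_related by (auto simp: vec_eq_iff block_nth B_iff)

lemma block_D_diagonal: "M \<in> \<D> \<Longrightarrow> U \<in> fibres R I \<Longrightarrow> block U U M = 0"
  using fibre_related by (auto simp: vec_eq_iff block_nth D_iff)

text \<open>A relation with index in \<open>I\<close> occurs in every fibre: the number of its
  neighbours of a point \<open>u\<close> is the intersection number at \<open>idx u u = 0\<close>,
  hence independent of \<open>u\<close>, and these neighbours stay in the fibre of
  \<open>u\<close>.\<close>

lemma block_B_nonzero:
  assumes M: "M \<in> \<B>" "M \<noteq> 0" and U: "U \<in> fibres R I"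
  shows "block U U M \<noteq> 0"
proof -
  obtain x y where xy: "M $ x $ y \<noteq> 0" using M(2) by (auto simp: vec_eq_iff)
  obtain c where c: "\<And>x y. M $ x $ y = c (idx x y)" using M(1) unfolding B_iff A_iff by blast
  have i: "idx x y \<in> I" using xy M(1) by (auto simp: B_iff)
  obtain p where p: "\<And>x y i j. i \<le> d \<Longrightarrow> j \<le> d \<Longrightarrow>
      card {z. idx x z = i \<and> idx z y = j} = p (idx x y) i j"
    using intersection_numbers by blast
  let ?N = "\<lambda>u. {z. idx u z = idx x y \<and> idx z u = idx x y}"
  obtain u where u: "u \<in> U" using fibre_nonempty[OF U] by auto
  have "y \<in> ?N x" by (simp add: idx_sym)
  then have "card (?N x) \<noteq> 0" by (metis card_0_eq empty_iff finite)
  moreover have "card (?N x) = card (?N u)" by (simp only: p[OF idx_bound idx_bound] idx_self)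
  ultimately have "?N u \<noteq> {}" by (metis card.empty)
  then obtain v where v: "idx u v = idx x y" by auto
  obtain V where V: "V \<in> fibres R I" "v \<in> V" using fibre_exists by blast
  have "v \<in> U" using fibre_related[OF U V(1) u V(2)] v i V(2) by simp
  then have "block U U M $ u $ v \<noteq> 0" using u v c xy by (simp add: block_nth)
  then show ?thesis by auto
qed

text \<open>Uniformity makes every index outside \<open>I\<close> occur between any two distinct
  fibres.\<close>

lemma block_D_nonzero:
  assumes M: "M \<in> \<D>" "M \<noteq> 0" and UV: "U \<in> fibres R I" "V \<in> fibres R I" "U \<noteq> V"
  shows "block U V M \<noteq> 0"
proof -
  obtain x y where xy: "M $ x $ y \<noteq> 0" using M(2) by (auto simp: vec_eq_iff)
  obtain c where c: "\<And>x y. M $ x $ y = c (idx x y)" using M(1) unfolding D_iff A_iff by blast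
  have "idx x y \<notin> I" using xy M(1) by (auto simp: D_iff)
  then have "idx x y \<in> index_set d R U V"
    using uniform UV idx_bound by (auto simp: uniform_scheme_def)
  then obtain u v where "u \<in> U" "v \<in> V" "idx u v = idx x y"
    using in_R_iff idx_bound by (auto simp: index_set_def)
  then have "block U V M $ u $ v \<noteq> 0" using c xy by (simp add: block_nth)
  then show ?thesis by auto
qed

lemma distinct_fibres:
  assumes "M \<in> \<D>" "M \<noteq> 0"
  obtains U V where "U \<in> fibres R I" "V \<in> fibres R I" "U \<noteq> V"
proof -
  obtain x y where "M $ x $ y \<noteq> 0" using assms(2) by (auto simp: vec_eq_iff)
  then have "idx x y \<notin> I" using assms by (auto simp: D_iff)
  moreover obtain U V where "U \<in> fibres R I" "V \<in> fibres R I" "x \<in> U" "y \<in> V"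
    using fibre_exists by meson
  ultimately show ?thesis using that fibre_related by blast
qed

lemma matrix_eq_by_blocks:
  assumes "\<And>U V. U \<in> fibres R I \<Longrightarrow> V \<in> fibres R I \<Longrightarrow> block U V M = block U V N"
  shows "M = N"
proof -
  have "M $ x $ y = N $ x $ y" for x y
  proof -
    obtain U V where UV: "U \<in> fibres R I" "V \<in> fibres R I" "x \<in> U" "y \<in> V"
      using fibre_exists by meson
    then have "block U V M $ x $ y = block U V N $ x $ y" using assms by simp
    then show ?thesis using UV by (simp add: block_nth)
  qed
  then show ?thesis by (simp add: vec_eq_iff)
qed

text \<open>A nonzero entry of \<open>M\<close> joins two points of one fibre, and a union of fibres
  contains both or neither.\<close>

lemma diag_indicator_commute_B:
  assumes "M \<in> \<B>" "\<U> \<subseteq> fibres R I"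
  shows "diag_indicator (\<Union>\<U>) ** M = M ** diag_indicator (\<Union>\<U>)"
proof -
  have "x \<in> \<Union>\<U> \<longleftrightarrow> y \<in> \<Union>\<U>" if "M $ x $ y \<noteq> 0" for x y
  proof -
    have "idx x y \<in> I" using that assms by (auto simp: B_iff)
    moreover obtain U V where "U \<in> fibres R I" "V \<in> fibres R I" "x \<in> U" "y \<in> V"
      using fibre_exists by meson
    ultimately show ?thesis using fibre_related fibre_disjoint assms(2) by blast
  qed
  then show ?thesis by (auto simp: vec_eq_iff diag_indicator_mult_nth mult_diag_indicator_nth)
qed

lemma B_mult_block:
  assumes "M \<in> \<B>" "\<U> \<subseteq> fibres R I"
  shows "M ** block (\<Union>\<U>) Z N = block (\<Union>\<U>) Z (M ** N)"
  unfolding block_def by (metis diag_indicator_commute_B[OF assms] matrix_mul_assoc)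

lemma B_mult_fibre_block:
  "M \<in> \<B> \<Longrightarrow> U \<in> fibres R I \<Longrightarrow> M ** block U Z N = block U Z (M ** N)"
  using B_mult_block[of M "{U}"] by simp

text \<open>The bilinear extension of the uniformity condition to \<open>\<D>\<close>. A single
  \<open>G\<close> serves all fibres, and \<open>U = W\<close> is allowed, so both return products
  and products through three distinct fibres are covered.\<close>

lemma block_mult_block_D:
  assumes "C \<in> \<D>" "C' \<in> \<D>"
  obtains G where "G \<in> \<A>" "\<And>U V W. \<lbrakk>U \<in> fibres R I; V \<in> fibres R I; W \<in> fibres R I; U \<noteq> V; V \<noteq> W\<rbrakk>
    \<Longrightarrow> block U V C ** block V W C' = block U W G"
proof -
  let ?J = "{..d} - I" and ?A = "\<lambda>i. adjacency_matrix (R i)"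
  have idx_set: "index_set d R U V = ?J" if "U \<in> fibres R I" "V \<in> fibres R I" "U \<noteq> V" for U V
    using uniform that by (auto simp: uniform_scheme_def)
  obtain a :: "nat \<Rightarrow> nat \<Rightarrow> nat \<Rightarrow> int" where
    "\<forall>U\<in>fibres R I. \<forall>V\<in>fibres R I. \<forall>W\<in>fibres R I.
        \<forall>i\<in>index_set d R U V. \<forall>j\<in>index_set d R V W.
          block U V (?A i) ** block V W (?A j) =
          (\<Sum>h\<le>d. of_int (a h i j) *\<^sub>R block U W (?A h))"
    using uniform unfolding uniform_scheme_def by (elim conjE exE) (rule that)
  then have a: "block U V (?A i) ** block V W (?A j) =
      block U W (\<Sum>h\<le>d. of_int (a h i j) *\<^sub>R ?A h)"
    if "U \<in> fibres R I" "V \<in> fibres R I" "W \<in> fibres R I" "U \<noteq> V" "V \<noteq> W" "i \<in> ?J" "j \<in> ?J"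
    for U V W i j
    using that idx_set by (simp add: block_sum block_scaleR)
  obtain c c' where c: "C = (\<Sum>i\<in>?J. c i *\<^sub>R ?A i)" "C' = (\<Sum>i\<in>?J. c' i *\<^sub>R ?A i)"
    using assms unfolding adjacency_span_eq[OF Diff_subset] by (elim CollectE exE) (rule that)
  define G where "G = (\<Sum>i\<in>?J. \<Sum>j\<in>?J. (c i * c' j) *\<^sub>R (\<Sum>h\<le>d. of_int (a h i j) *\<^sub>R ?A h))"
  have "G \<in> \<A>"
    unfolding G_def bose_mesner_algebra_def adjacency_span_def
    by (intro span_sum span_scale span_base) auto
  moreover have "block U V C ** block V W C' = block U W G"
    if UVW: "U \<in> fibres R I" "V \<in> fibres R I" "W \<in> fibres R I" "U \<noteq> V" "V \<noteq> W" for U V W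
  proof -
    have "block U V C ** block V W C' =
        (\<Sum>i\<in>?J. \<Sum>j\<in>?J. (c i * c' j) *\<^sub>R (block U V (?A i) ** block V W (?A j)))"
      unfolding c block_sum block_scaleR matrix_mult.sum_left matrix_mult.sum_right
        matrix_mult.scaleR_left matrix_mult.scaleR_right scaleR_sum_right
      by (subst sum.swap) (simp add: mult.commute)
    also have "\<dots> = (\<Sum>i\<in>?J. \<Sum>j\<in>?J. (c i * c' j) *\<^sub>R
        block U W (\<Sum>h\<le>d. of_int (a h i j) *\<^sub>R ?A h))"
      by (intro sum.cong refl) (simp only: a[OF UVW])
    also have "\<dots> = block U W G"
      by (simp only: G_def block_sum block_scaleR)
    finally show ?thesis .
  qed
  ultimately show ?thesis using that by blast
qed

subsection \<open>Splitting a primitive idempotent\<close>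

lemma primitive_idempotent_in_B:
  assumes "primitive_idempotent \<B> F"
  shows "F \<in> \<B>" "F ** F = F" "F \<noteq> 0" and "M \<in> \<B> \<Longrightarrow> \<exists>c. F ** M = c *\<^sub>R F"
proof -
  show F: "F \<in> \<B>" and "F ** F = F" "F \<noteq> 0"
    using assms by (auto simp: primitive_idempotent_def)
  show "\<exists>c. F ** M = c *\<^sub>R F" if "M \<in> \<B>"
    using assms that A_commute[OF B_sub_A[OF F] B_sub_A[OF that]]
    by (auto simp: primitive_idempotent_def)
qed

text \<open>As \<open>M\<close> commutes with the indicator of a union of fibres, restriction
  respects products in which one factor lies in \<open>\<B>\<close>.\<close>

lemma B_restrict_mult:
  assumes "M \<in> \<B>" "\<U> \<subseteq> fibres R I"
  shows "block (\<Union>\<U>) (\<Union>\<U>) M ** block (\<Union>\<U>) Z N = block (\<Union>\<U>) Z (M ** N)"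
  unfolding block_mult_block using diag_indicator_commute_B[OF assms]
  by (simp add: block_def) (metis diag_indicator_idem matrix_mul_assoc)

lemma mult_B_restrict:
  assumes "M \<in> \<B>" "\<U> \<subseteq> fibres R I"
  shows "block Z (\<Union>\<U>) N ** block (\<Union>\<U>) (\<Union>\<U>) M = block Z (\<Union>\<U>) (N ** M)"
  unfolding block_mult_block using diag_indicator_commute_B[OF assms]
  by (simp add: block_def) (metis diag_indicator_idem matrix_mul_assoc)

lemma B_block_mult_block:
  "M \<in> \<B> \<Longrightarrow> Y \<in> fibres R I \<Longrightarrow> block Y Y M ** block Y Z N = block Y Z (M ** N)"
  using B_restrict_mult[of M "{Y}"] by simp

lemma block_mult_B_block:
  "M \<in> \<B> \<Longrightarrow> Y \<in> fibres R I \<Longrightarrow> block Z Y N ** block Y Y M = block Z Y (N ** M)"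
  using mult_B_restrict[of M "{Y}"] by simp

text \<open>The product is a diagonal block, so it sees only the \<open>\<B>\<close>-part
  \<open>G1\<close> of \<open>G\<close>. Multiplication by \<open>F\<close> fixes it because it
  fixes \<open>C\<close>, while \<open>F ** G1\<close> is a multiple of \<open>F\<close> by
  primitivity.\<close>

lemma block_product_return:
  assumes F: "primitive_idempotent \<B> F" and C: "C \<in> \<D>" "F ** C = C" and C': "C' \<in> \<D>"
  obtains b where "\<And>U V. \<lbrakk>U \<in> fibres R I; V \<in> fibres R I; U \<noteq> V\<rbrakk> \<Longrightarrow>
    block U V C ** block V U C' = b *\<^sub>R block U U F"
proof -
  note FB = primitive_idempotent_in_B[OF F]
  obtain G where G: "G \<in> \<A>" "\<And>U V W. \<lbrakk>U \<in> fibres R I; V \<in> fibres R I; W \<in> fibres R I; U \<noteq> V; V \<noteq> W\<rbrakk>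
      \<Longrightarrow> block U V C ** block V W C' = block U W G"
    using block_mult_block_D[OF C(1) C'] by blast
  obtain G1 G2 where G12: "G1 \<in> \<B>" "G2 \<in> \<D>" "G = G1 + G2" using A_split[OF G(1)] by blast
  obtain b where b: "F ** G1 = b *\<^sub>R F" using FB(4) G12(1) by blast
  have "block U V C ** block V U C' = b *\<^sub>R block U U F"
    if UV: "U \<in> fibres R I" "V \<in> fibres R I" "U \<noteq> V" for U V
  proof -
    have G1: "block U V C ** block V U C' = block U U G1"
      using G(2)[OF UV(1,2,1)] UV G12 block_D_diagonal by (simp add: block_add)
    have "block U V C ** block V U C' = F ** (block U V C ** block V U C')"
      using UV FB C by (simp add: matrix_mul_assoc B_mult_fibre_block)
    also have "\<dots> = b *\<^sub>R block U U F"
      unfolding G1 using UV FB b by (simp add: B_mult_fibre_block block_scaleR)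
    finally show ?thesis .
  qed
  then show ?thesis using that by blast
qed

text \<open>Positivity comes from comparing one diagonal entry on both sides: by symmetry the entry
  on the left is a sum of squares, not all zero, and that of \<open>F = F ** F\<close> is a sum of
  squares too.\<close>

lemma block_square_return:
  assumes F: "primitive_idempotent \<B> F" and C: "C \<in> \<D>" "F ** C = C" "C \<noteq> 0"
  obtains b where "b > 0" "\<And>U V. \<lbrakk>U \<in> fibres R I; V \<in> fibres R I; U \<noteq> V\<rbrakk> \<Longrightarrow>
    block U V C ** block V U C = b *\<^sub>R block U U F"
proof -
  note FB = primitive_idempotent_in_B[OF F]
  obtain b where b: "\<And>U V. \<lbrakk>U \<in> fibres R I; V \<in> fibres R I; U \<noteq> V\<rbrakk> \<Longrightarrow>
    block U V C ** block V U C = b *\<^sub>R block U U F"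
    using block_product_return[OF F C(1,2,1)] by blast
  obtain x y where xy: "C $ x $ y \<noteq> 0" using C(3) by (auto simp: vec_eq_iff)
  obtain U V where UV: "U \<in> fibres R I" "V \<in> fibres R I" "x \<in> U" "y \<in> V"
    using fibre_exists by meson
  have "idx x y \<notin> I" using xy C(1) by (auto simp: D_iff)
  then have "U \<noteq> V" using fibre_related[OF UV] by simp
  have "(block U V C ** block V U C) $ x $ x = (\<Sum>z\<in>UNIV. (block U V C $ x $ z)\<^sup>2)"
    using A_entry_sym[OF D_sub_A[OF C(1)]]
    by (auto simp: matrix_matrix_mult_def block_nth power2_eq_square intro!: sum.cong)
  also have "\<dots> > 0"
    by (rule sum_pos2[where i = y]) (use xy UV in \<open>auto simp: block_nth\<close>)
  finally have "b * F $ x $ x > 0" using b[OF UV(1,2) \<open>U \<noteq> V\<close>] UV by (simp add: block_nth)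
  moreover have "F $ x $ x \<ge> 0"
  proof -
    have "F $ x $ x = (F ** F) $ x $ x" using FB by simp
    also have "\<dots> = (\<Sum>z\<in>UNIV. (F $ x $ z)\<^sup>2)"
      using A_entry_sym[OF B_sub_A[OF FB(1)]]
      by (auto simp: matrix_matrix_mult_def power2_eq_square intro!: sum.cong)
    finally show ?thesis by (simp add: sum_nonneg)
  qed
  ultimately have "b > 0" by (auto simp: zero_less_mult_iff)
  then show ?thesis using that b by blast
qed

text \<open>The ideal \<open>F ** \<D>\<close> is at most one-dimensional: up to a positive scalar, the block
  \<open>block V U C\<close> is a two-sided inverse of \<open>block U V C\<close> on the range of \<open>F\<close>.\<close>

lemma F_D_one_dimensional:
  assumes F: "primitive_idempotent \<B> F" and C: "C \<in> \<D>" "F ** C = C" "C \<noteq> 0"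
    and C': "C' \<in> \<D>" "F ** C' = C'"
  obtains k where "C' = k *\<^sub>R C"
proof -
  note FB = primitive_idempotent_in_B[OF F]
  obtain U V where UV: "U \<in> fibres R I" "V \<in> fibres R I" "U \<noteq> V"
    using distinct_fibres[OF C(1,3)] by blast
  obtain c where c: "c > 0" "block V U C ** block U V C = c *\<^sub>R block V V F"
    using block_square_return[OF F C] UV by metis
  obtain b where b: "block U V C ** block V U C' = b *\<^sub>R block U U F"
    using block_product_return[OF F C(1,2) C'(1)] UV by metis
  have CF: "C ** F = C"
    using A_commute[OF B_sub_A[OF FB(1)] D_sub_A[OF C(1)]] C(2) by simp
  \<comment> \<open>The product \<open>block V U C ** block U V C ** block V U C'\<close> is
    evaluated with both bracketings.\<close>
  have "c *\<^sub>R block V U C' = (c *\<^sub>R block V V F) ** block V U C'"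
    using B_block_mult_block[OF FB(1)] UV C'(2) by (simp add: matrix_mult.scaleR_left)
  also have "\<dots> = block V U C ** (block U V C ** block V U C')"
    by (simp add: c(2)[symmetric] matrix_mul_assoc)
  also have "\<dots> = b *\<^sub>R block V U C"
    using block_mult_B_block[OF FB(1)] UV CF by (simp add: b matrix_mult.scaleR_right)
  finally have "block V U (c *\<^sub>R C' - b *\<^sub>R C) = 0"
    by (simp add: block_diff block_scaleR)
  \<comment> \<open>An element of \<open>\<D>\<close> that vanishes on one off-diagonal block is
    zero.\<close>
  then have "c *\<^sub>R C' - b *\<^sub>R C = 0"
    using block_D_nonzero[of "c *\<^sub>R C' - b *\<^sub>R C" V U] UV C C' subspace_D
    by (metis subspace_diff subspace_scale)
  then have "(1 / c) *\<^sub>R (c *\<^sub>R C') = (1 / c) *\<^sub>R (b *\<^sub>R C)" by simp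
  then have "C' = (b / c) *\<^sub>R C" using c(1) by simp
  then show ?thesis using that by blast
qed

lemma normalized_D_element:
  assumes F: "primitive_idempotent \<B> F" and C: "C \<in> \<D>" "F ** C = C" "C \<noteq> 0"
  obtains D where "D \<in> \<D>" "F ** D = D" "D \<noteq> 0"
    "\<And>U V. \<lbrakk>U \<in> fibres R I; V \<in> fibres R I; U \<noteq> V\<rbrakk> \<Longrightarrow>
      block U V D ** block V U D = block U U F"
    "\<And>U V W. \<lbrakk>U \<in> fibres R I; V \<in> fibres R I; W \<in> fibres R I; U \<noteq> V; V \<noteq> W; U \<noteq> W\<rbrakk> \<Longrightarrow>
      block U V D ** block V W D = block U W D"
proof -
  note FB = primitive_idempotent_in_B[OF F]
  obtain b where b: "b > 0" "\<And>U V. \<lbrakk>U \<in> fibres R I; V \<in> fibres R I; U \<noteq> V\<rbrakk> \<Longrightarrow>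
      block U V C ** block V U C = b *\<^sub>R block U U F"
    using block_square_return[OF F C] by blast
  \<comment> \<open>This scaling makes every return product equal to the block of \<open>F\<close>;
    only a sign remains free.\<close>
  define N where "N = (1 / sqrt b) *\<^sub>R C"
  have N: "N \<in> \<D>" "F ** N = N" "N \<noteq> 0"
    using C b(1) subspace_D by (auto simp: N_def subspace_scale matrix_mult.scaleR_right)
  have NF: "N ** F = N" using A_commute[OF B_sub_A[OF FB(1)] D_sub_A[OF N(1)]] N(2) by simp
  have NN: "block U V N ** block V U N = block U U F"
    if "U \<in> fibres R I" "V \<in> fibres R I" "U \<noteq> V" for U V
    using b(2)[OF that] b(1)
    by (simp add: N_def block_scaleR matrix_mult.scaleR_left matrix_mult.scaleR_right)
  obtain G where G: "G \<in> \<A>" "\<And>U V W. \<lbrakk>U \<in> fibres R I; V \<in> fibres R I; W \<in> fibres R I; U \<noteq> V; V \<noteq> W\<rbrakk>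
      \<Longrightarrow> block U V N ** block V W N = block U W G"
    using block_mult_block_D[OF N(1) N(1)] by blast
  obtain G1 G2 where G12: "G1 \<in> \<B>" "G2 \<in> \<D>" "G = G1 + G2" using A_split[OF G(1)] by blast
  have "F ** (F ** G2) = F ** G2" using FB(2) by (simp add: matrix_mul_assoc)
  \<comment> \<open>\<open>F ** G2\<close> lies in the at most one-dimensional ideal
    \<open>F ** \<D>\<close>, hence is a multiple of \<open>N\<close>.\<close>
  then obtain g where g: "F ** G2 = g *\<^sub>R N"
    using F_D_one_dimensional[OF F N B_mult_D[OF FB(1) G12(2)]] by blast
  have NNN: "block U V N ** block V W N = g *\<^sub>R block U W N"
    if UVW: "U \<in> fibres R I" "V \<in> fibres R I" "W \<in> fibres R I" "U \<noteq> V" "V \<noteq> W" "U \<noteq> W" for U V W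
  proof -
    have G2: "block U V N ** block V W N = block U W G2"
      using G(2)[OF UVW(1-5)] UVW G12 block_B_off_diagonal by (simp add: block_add)
    have "block U V N ** block V W N = F ** (block U V N ** block V W N)"
      using UVW FB N by (simp add: matrix_mul_assoc B_mult_fibre_block)
    also have "\<dots> = g *\<^sub>R block U W N"
      unfolding G2 using UVW FB g by (simp add: B_mult_fibre_block block_scaleR)
    finally show ?thesis .
  qed
  show ?thesis
  proof (cases "\<exists>U V W. U \<in> fibres R I \<and> V \<in> fibres R I \<and> W \<in> fibres R I \<and> U \<noteq> V \<and> V \<noteq> W \<and> U \<noteq> W")
    case True
    then obtain U V W where UVW: "U \<in> fibres R I" "V \<in> fibres R I" "W \<in> fibres R I"
      "U \<noteq> V" "V \<noteq> W" "U \<noteq> W" by blast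
    \<comment> \<open>The closed walk through \<open>U\<close>, \<open>V\<close>, \<open>W\<close>,
      \<open>V\<close>, \<open>U\<close> is evaluated twice: collapsing the middle return gives
      \<open>F\<close>, while pairing its steps gives \<open>g * g\<close> times
      \<open>F\<close>.\<close>
    have "block U U F = block U V N ** block V V F ** block V U N"
      using UVW NN NF by (simp add: block_mult_B_block[OF FB(1)])
    also have "\<dots> = (block U V N ** block V W N) ** (block W V N ** block V U N)"
      using UVW NN[of V W] by (metis matrix_mul_assoc)
    also have "\<dots> = (g * g) *\<^sub>R block U U F"
      using UVW NNN[of U V W] NNN[of W V U] NN[of U W]
      by (simp add: matrix_mult.scaleR_left matrix_mult.scaleR_right)
    finally have "(g * g - 1) *\<^sub>R block U U F = 0" by (simp add: scaleR_diff_left)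
    then have gg: "g * g = 1" using block_B_nonzero[OF FB(1,3) UVW(1)] by simp
    then have "g \<noteq> 0" by auto
    \<comment> \<open>Since \<open>g * g = 1\<close>, return products are unchanged, and the product
      through three distinct fibres becomes \<open>g *\<^sub>R N\<close> itself.\<close>
    show ?thesis
    proof (rule that[of "g *\<^sub>R N"])
      show "g *\<^sub>R N \<in> \<D>" "F ** (g *\<^sub>R N) = g *\<^sub>R N" "g *\<^sub>R N \<noteq> 0"
        using N subspace_D \<open>g \<noteq> 0\<close> by (auto simp: subspace_scale matrix_mult.scaleR_right)
    qed (simp_all add: block_scaleR matrix_mult.scaleR_left matrix_mult.scaleR_right NN NNN gg)
  next
    case False
    \<comment> \<open>Without three distinct fibres the last condition is vacuous, and
      \<open>N\<close> serves.\<close>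
    show ?thesis by (rule that[OF N NN]) (use False in blast)+
  qed
qed

text \<open>The sandwich identity yields idempotents after restriction; the last property says that
  the ideal of \<open>\<A>\<close> generated by \<open>F\<close> is spanned by \<open>F\<close> and
  \<open>D\<close>, so \<open>F\<close> splits into two pieces.\<close>

lemma splitting_D_element:
  assumes F: "primitive_idempotent \<B> F" and nprim: "\<not> primitive_idempotent \<A> F"
  obtains D where "D \<in> \<D>" "F ** D = D" "D \<noteq> 0"
    "\<And>V. V \<in> fibres R I \<Longrightarrow> (F + D) ** diag_indicator V ** (F + D) = F + D"
    "\<And>A. A \<in> \<A> \<Longrightarrow> \<exists>a b. A ** F = a *\<^sub>R F + b *\<^sub>R D"
proof -
  note FB = primitive_idempotent_in_B[OF F]
  have idemp: "F ** (F ** M) = F ** M" for M using FB(2) by (simp add: matrix_mul_assoc)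
  have A_F_split: "\<exists>a. \<exists>A2\<in>\<D>. A ** F = a *\<^sub>R F + F ** A2" if A: "A \<in> \<A>" for A
  proof -
    obtain A1 A2 where A12: "A1 \<in> \<B>" "A2 \<in> \<D>" "A = A1 + A2" using A_split[OF A] by blast
    obtain a where "F ** A1 = a *\<^sub>R F" using FB(4) A12(1) by blast
    then have "A ** F = a *\<^sub>R F + F ** A2"
      using A_commute[OF A B_sub_A[OF FB(1)]] A12(3) by (simp add: matrix_mult.add_right)
    then show ?thesis using A12(2) by blast
  qed
  \<comment> \<open>\<open>F\<close> meets the other clauses of primitivity in \<open>\<A>\<close>,
    so only the scalar action can fail.\<close>
  obtain A where A: "A \<in> \<A>" "\<And>c. A ** F \<noteq> c *\<^sub>R F"
    using nprim FB B_sub_A unfolding primitive_idempotent_def by blast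
  obtain a A2 where A2: "A2 \<in> \<D>" "A ** F = a *\<^sub>R F + F ** A2" using A_F_split[OF A(1)] by blast
  have "F ** A2 \<noteq> 0" using A(2)[of a] A2(2) by auto
  then obtain D where D: "D \<in> \<D>" "F ** D = D" "D \<noteq> 0"
    and DD: "\<And>U V. \<lbrakk>U \<in> fibres R I; V \<in> fibres R I; U \<noteq> V\<rbrakk> \<Longrightarrow>
      block U V D ** block V U D = block U U F"
    and DDD: "\<And>U V W. \<lbrakk>U \<in> fibres R I; V \<in> fibres R I; W \<in> fibres R I; U \<noteq> V; V \<noteq> W; U \<noteq> W\<rbrakk> \<Longrightarrow>
      block U V D ** block V W D = block U W D"
    using normalized_D_element[OF F B_mult_D[OF FB(1) A2(1)] idemp] by blast
  have DF: "D ** F = D" using A_commute[OF B_sub_A[OF FB(1)] D_sub_A[OF D(1)]] D(2) by simp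
  have diag: "block U U (F + D) = block U U F" if "U \<in> fibres R I" for U
    using block_D_diagonal[OF D(1) that] by (simp add: block_add)
  have off: "block U V (F + D) = block U V D" if "U \<in> fibres R I" "V \<in> fibres R I" "U \<noteq> V" for U V
    using block_B_off_diagonal[OF FB(1) that] by (simp add: block_add)
  have "(F + D) ** diag_indicator V ** (F + D) = F + D" if V: "V \<in> fibres R I" for V
  proof (rule matrix_eq_by_blocks)
    fix U W assume UW: "U \<in> fibres R I" "W \<in> fibres R I"
    \<comment> \<open>On diagonal blocks \<open>F + D\<close> is \<open>F\<close>, elsewhere it is
      \<open>D\<close>. The cases are \<open>F ** F\<close>, \<open>F ** D\<close>,
      \<open>D ** F\<close>, a return product, and a product through three distinct fibres.\<close>
    have "block U V (F + D) ** block V W (F + D) = block U W (F + D)"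
      using UW V FB(2) D(2) DF
      by (cases "U = V"; cases "V = W"; cases "U = W")
        (simp_all add: diag off B_block_mult_block[OF FB(1)] block_mult_B_block[OF FB(1)] DD DDD)
    then show "block U W ((F + D) ** diag_indicator V ** (F + D)) = block U W (F + D)"
      by (simp add: block_mult_block)
  qed
  moreover have "\<exists>a b. A ** F = a *\<^sub>R F + b *\<^sub>R D" if "A \<in> \<A>" for A
  proof -
    obtain a A2 where A2: "A2 \<in> \<D>" "A ** F = a *\<^sub>R F + F ** A2" using A_F_split[OF \<open>A \<in> \<A>\<close>] by blast
    obtain b where "F ** A2 = b *\<^sub>R D"
      using F_D_one_dimensional[OF F D B_mult_D[OF FB(1) A2(1)] idemp] by blast
    then show ?thesis using A2(2) by auto
  qed
  ultimately show ?thesis using that D by blast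
qed

section \<open>Restriction to a union of fibres\<close>

lemma diag_indicator_Union:
  assumes "\<U> \<subseteq> fibres R I"
  shows "diag_indicator (\<Union>\<U>) = (\<Sum>V\<in>\<U>. diag_indicator V)"
proof -
  have "(\<Sum>V\<in>\<U>. diag_indicator V :: real^'x^'x) $ x $ y = diag_indicator (\<Union>\<U>) $ x $ y" for x y
  proof (cases "x = y \<and> x \<in> \<Union>\<U>")
    case True
    then obtain U where U: "U \<in> \<U>" "x \<in> U" by auto
    have "x \<in> V \<longleftrightarrow> V = U" if "V \<in> \<U>" for V
      using U that assms fibre_disjoint[of V U x] by blast
    then have "(\<Sum>V\<in>\<U>. diag_indicator V :: real^'x^'x) $ x $ y = (\<Sum>V\<in>\<U>. if V = U then 1 else 0)"
      unfolding sum_component using True by (intro sum.cong) (simp_all add: diag_indicator_def)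
    also have "\<dots> = 1" using U by simp
    also have "1 = diag_indicator (\<Union>\<U>) $ x $ y"
      unfolding diag_indicator_def vec_lambda_beta if_P[OF True] ..
    finally show ?thesis .
  next
    case False
    then show ?thesis by (auto simp: diag_indicator_def intro!: sum.neutral)
  qed
  then show ?thesis by (simp add: vec_eq_iff del: sum_component)
qed

text \<open>The indicator of the union is the sum of the fibre indicators, and each fibre
  contributes one copy of \<open>M\<close>.\<close>

lemma restricted_square:
  assumes U: "\<U> \<subseteq> fibres R I"
    and M: "\<And>V. V \<in> fibres R I \<Longrightarrow> M ** diag_indicator V ** M = M"
  shows "restrict_to (\<Union>\<U>) M ** restrict_to (\<Union>\<U>) M = real (card \<U>) *\<^sub>R restrict_to (\<Union>\<U>) M"
proof -
  have "M ** diag_indicator (\<Union>\<U>) ** M = (\<Sum>V\<in>\<U>. M ** diag_indicator V ** M)"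
    by (simp add: diag_indicator_Union[OF U] matrix_mult.sum_left matrix_mult.sum_right)
  also have "\<dots> = (\<Sum>V\<in>\<U>. M)" using U M by (intro sum.cong) auto
  also have "\<dots> = real (card \<U>) *\<^sub>R M" by (simp only: sum_constant_scaleR)
  finally show ?thesis by (simp add: block_mult_block block_scaleR)
qed

lemma restrict_A_symmetric: "M \<in> restrict_to Y ` \<A> \<Longrightarrow> transpose M = M"
  using A_symmetric by (auto simp: transpose_block)

text \<open>Restriction is compatible with multiplication by \<open>F\<close>, so scalar actions on
  \<open>F\<close> survive; a single fibre block shows that the restriction is nonzero.\<close>

lemma restricted_primitive_idempotent:
  assumes F: "primitive_idempotent \<B> F" "primitive_idempotent \<A> F"
    and U: "\<U> \<subseteq> fibres R I" "\<U> \<noteq> {}"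
  shows "primitive_idempotent (restrict_to (\<Union>\<U>) ` \<A>) (restrict_to (\<Union>\<U>) F)"
proof -
  note FB = primitive_idempotent_in_B[OF F(1)]
  obtain V where V: "V \<in> \<U>" using U(2) by blast
  have "block V V (restrict_to (\<Union>\<U>) F) = block V V F"
    using V by (intro block_block_subset) auto
  then have "restrict_to (\<Union>\<U>) F \<noteq> 0"
    using block_B_nonzero[OF FB(1,3), of V] V U(1) by auto
  moreover have "\<exists>c. restrict_to (\<Union>\<U>) A ** restrict_to (\<Union>\<U>) F = c *\<^sub>R restrict_to (\<Union>\<U>) F"
    if "A \<in> \<A>" for A
  proof -
    obtain c where "A ** F = c *\<^sub>R F" using F(2) \<open>A \<in> \<A>\<close> by (auto simp: primitive_idempotent_def)
    then show ?thesis using mult_B_restrict[OF FB(1) U(1)] by (auto simp: block_scaleR)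
  qed
  ultimately show ?thesis
    using B_sub_A[OF FB(1)] FB(2) B_restrict_mult[OF FB(1) U(1)]
    unfolding primitive_idempotent_def by auto
qed

text \<open>Any restricted element of \<open>\<A>\<close> times the restriction of \<open>F\<close>
  is a combination of that restriction and \<open>P\<close>. Multiplying by one of the two
  orthogonal idempotents leaves only a multiple of it.\<close>

lemma restricted_split_idempotents:
  assumes F: "primitive_idempotent \<B> F"
    and D: "D \<in> \<D>" "F ** D = D" "D \<noteq> 0"
    and M: "\<And>V. V \<in> fibres R I \<Longrightarrow> (F + D) ** diag_indicator V ** (F + D) = F + D"
    and A: "\<And>A. A \<in> \<A> \<Longrightarrow> \<exists>a b. A ** F = a *\<^sub>R F + b *\<^sub>R D"
    and U: "\<U> \<subseteq> fibres R I" "card \<U> \<ge> 2"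
  defines "Y \<equiv> \<Union>\<U>"
  defines "P \<equiv> (1 / real (card \<U>)) *\<^sub>R (restrict_to Y F + restrict_to Y D)"
  shows "primitive_idempotent (restrict_to Y ` \<A>) P"
    and "primitive_idempotent (restrict_to Y ` \<A>) (restrict_to Y F - P)"
proof -
  note FB = primitive_idempotent_in_B[OF F]
  let ?w = "real (card \<U>)" and ?F = "restrict_to Y F"
  have w: "?w \<noteq> 0" using U(2) by linarith
  have P_eq: "P = restrict_to Y ((1 / ?w) *\<^sub>R (F + D))"
    by (simp add: P_def block_scaleR block_add)
  have DY: "restrict_to Y D = ?w *\<^sub>R P - ?F" using w by (simp add: P_def del: of_nat_eq_0_iff)
  have PP: "P ** P = P"
    using restricted_square[OF U(1) M] w
    by (simp add: P_eq block_scaleR matrix_mult.scaleR_left matrix_mult.scaleR_right Y_def)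
  have DF: "D ** F = D" using A_commute[OF B_sub_A[OF FB(1)] D_sub_A[OF D(1)]] D(2) by simp
  have FP: "?F ** P = P" and PF: "P ** ?F = P" and FF: "?F ** ?F = ?F"
    unfolding P_eq Y_def B_restrict_mult[OF FB(1) U(1)] mult_B_restrict[OF FB(1) U(1)]
    using FB(2) D(2) DF
    by (simp_all add: matrix_mult.scaleR_left matrix_mult.scaleR_right matrix_mult.add_left
        matrix_mult.add_right)
  have AF: "\<exists>a b. restrict_to Y A ** ?F = a *\<^sub>R ?F + b *\<^sub>R P" if AA: "A \<in> \<A>" for A
  proof -
    obtain a b where "A ** F = a *\<^sub>R F + b *\<^sub>R D" using A[OF AA] by blast
    then have "restrict_to Y A ** ?F = a *\<^sub>R ?F + b *\<^sub>R restrict_to Y D"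
      unfolding Y_def mult_B_restrict[OF FB(1) U(1)] by (simp add: block_add block_scaleR)
    also have "\<dots> = (a - b) *\<^sub>R ?F + (b * ?w) *\<^sub>R P"
      unfolding DY by (simp add: algebra_simps)
    finally show ?thesis by blast
  qed
  obtain V W where VW: "V \<in> \<U>" "W \<in> \<U>" "V \<noteq> W"
    using U(2) by (metis card_2_iff' card_le_Suc0_iff_eq finite not_less_eq_eq numeral_2_eq_2)
  then have VWf: "V \<in> fibres R I" "W \<in> fibres R I" using U(1) by auto
  have sub: "V \<subseteq> Y" "W \<subseteq> Y" using VW by (auto simp: Y_def)
  have "block V V P = (1 / ?w) *\<^sub>R block V V F"
    using sub block_D_diagonal[OF D(1) VWf(1)]
    by (simp add: P_def block_scaleR block_add block_block_subset)
  then have P0: "P \<noteq> 0" using block_B_nonzero[OF FB(1,3) VWf(1)] w by auto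
  \<comment> \<open>\<open>F\<close> has no block between distinct fibres, so there the difference
    is a nonzero multiple of \<open>D\<close>; this uses a second fibre.\<close>
  have "block V W (?F - P) = - (1 / ?w) *\<^sub>R block V W D"
    using sub block_B_off_diagonal[OF FB(1) VWf VW(3)]
    by (simp add: P_def block_scaleR block_add block_diff block_block_subset)
  then have Q0: "?F - P \<noteq> 0" using block_D_nonzero[OF D(1,3) VWf VW(3)] w by auto
  have P_in: "P \<in> restrict_to Y ` \<A>" unfolding P_eq
    by (intro imageI subspace_scale subspace_add subspace_A B_sub_A D_sub_A FB(1) D(1))
  have "?F - P = restrict_to Y (F - (1 / ?w) *\<^sub>R (F + D))" by (simp add: P_eq block_diff)
  also have "\<dots> \<in> restrict_to Y ` \<A>"
    by (intro imageI subspace_diff subspace_scale subspace_add subspace_A B_sub_A D_sub_A FB(1) D(1))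
  finally have Q_in: "?F - P \<in> restrict_to Y ` \<A>" .
  have FQ: "?F ** (?F - P) = ?F - P" by (simp add: matrix_mult.diff_right FF FP)
  have PQ: "P ** (?F - P) = 0" by (simp add: matrix_mult.diff_right PP PF)
  have "\<exists>c. B ** P = c *\<^sub>R P" if B: "B \<in> restrict_to Y ` \<A>" for B
  proof -
    obtain a b where ab: "B ** ?F = a *\<^sub>R ?F + b *\<^sub>R P" using B AF by fastforce
    \<comment> \<open>Inserting \<open>?F\<close>, which fixes \<open>P\<close>, reduces the action
      of \<open>B\<close> to \<open>AF\<close>.\<close>
    have "B ** P = B ** ?F ** P" by (simp add: FP flip: matrix_mul_assoc)
    also have "\<dots> = (a + b) *\<^sub>R P"
      by (simp add: ab matrix_mult.add_left matrix_mult.scaleR_left FP PP scaleR_add_left)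
    finally show ?thesis by blast
  qed
  then show "primitive_idempotent (restrict_to Y ` \<A>) P"
    using P_in P0 PP by (simp add: primitive_idempotent_def)
  have "\<exists>c. B ** (?F - P) = c *\<^sub>R (?F - P)" if B: "B \<in> restrict_to Y ` \<A>" for B
  proof -
    obtain a b where ab: "B ** ?F = a *\<^sub>R ?F + b *\<^sub>R P" using B AF by fastforce
    have "B ** (?F - P) = B ** ?F ** (?F - P)" by (simp add: FQ flip: matrix_mul_assoc)
    also have "\<dots> = a *\<^sub>R (?F - P)"
      by (simp add: ab matrix_mult.add_left matrix_mult.scaleR_left FQ PQ)
    finally show ?thesis by blast
  qed
  moreover have "(?F - P) ** (?F - P) = ?F - P"
    by (simp add: matrix_mult.diff_left FQ PQ)
  ultimately show "primitive_idempotent (restrict_to Y ` \<A>) (?F - P)"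
    using Q_in Q0 by (simp add: primitive_idempotent_def)
qed

end

theorem theorem4p10:
  fixes R :: "nat \<Rightarrow> ('x::finite \<times> 'x) set"
    and d e l :: nat
    and I :: "nat set"
    and F :: "nat \<Rightarrow> real^'x^'x"
  assumes "uniform_scheme d R I"
    and "inj_on F {..e}"
    and "F ` {..e} = {E. primitive_idempotent (adjacency_span R I) E}"
    and "l \<le> e + 1"
    and "\<forall>j<l. \<not> primitive_idempotent (bose_mesner_algebra d R) (F j)"
    and "\<forall>j\<in>{l..e}. primitive_idempotent (bose_mesner_algebra d R) (F j)"
  shows "\<exists>D :: nat \<Rightarrow> real^'x^'x.
    (\<forall>j<l. D j \<in> adjacency_span R ({..d} - I)) \<and>
    (\<forall>(w'::nat) \<U> Y. w' \<ge> 2 \<and> \<U> \<subseteq> fibres R I \<and> card \<U> = w' \<and> Y = \<Union>\<U> \<longrightarrow>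
      {E. primitive_idempotent (restrict_to Y ` bose_mesner_algebra d R) E} =
        (\<lambda>j. (1 / real w') *\<^sub>R (restrict_to Y (F j) + restrict_to Y (D j))) ` {..<l} \<union>
        (\<lambda>j. restrict_to Y (F j) -
              (1 / real w') *\<^sub>R (restrict_to Y (F j) + restrict_to Y (D j))) ` {..<l} \<union>
        (\<lambda>j. restrict_to Y (F j)) ` {l..e})"
proof -
  interpret uniform_association_scheme d R I by unfold_locales (rule assms(1))
  have primB: "primitive_idempotent \<B> (F j)" if "j \<le> e" for j
    using that assms(3) by blast
  have "\<Sum>(F ` {..e}) = mat 1"
    by (rule sum_primitive_idempotents[OF _ B_mult subspace_B mat_1_in_B _ assms(3)])
      (simp_all add: A_symmetric B_sub_A)
  then have sumF: "(\<Sum>j\<le>e. F j) = mat 1"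
    using assms(2) by (simp add: sum.reindex)
  \<comment> \<open>\<open>Q\<close> involves neither \<open>Y\<close> nor \<open>w'\<close>, so the
    \<open>D\<close> chosen from it serves all unions of fibres at once.\<close>
  define Q where "Q j D \<longleftrightarrow> D \<in> \<D> \<and> F j ** D = D \<and> D \<noteq> 0 \<and>
      (\<forall>V\<in>fibres R I. (F j + D) ** diag_indicator V ** (F j + D) = F j + D) \<and>
      (\<forall>A\<in>\<A>. \<exists>a b. A ** F j = a *\<^sub>R F j + b *\<^sub>R D)" for j D
  have "\<exists>D. Q j D" if "j < l" for j
  proof -
    have "j \<le> e" using that assms(4) by simp
    moreover have "\<not> primitive_idempotent \<A> (F j)" using that assms(5) by blast
    ultimately show ?thesis
      unfolding Q_def using splitting_D_element[OF primB, of j] by metis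
  qed
  then obtain D where D: "\<And>j. j < l \<Longrightarrow> Q j (D j)" by metis
  have "{E. primitive_idempotent (restrict_to Y ` \<A>) E} =
        (\<lambda>j. (1 / real w') *\<^sub>R (restrict_to Y (F j) + restrict_to Y (D j))) ` {..<l} \<union>
        (\<lambda>j. restrict_to Y (F j) -
              (1 / real w') *\<^sub>R (restrict_to Y (F j) + restrict_to Y (D j))) ` {..<l} \<union>
        (\<lambda>j. restrict_to Y (F j)) ` {l..e}" (is "?prim = ?L")
    if w: "w' \<ge> 2" and U: "\<U> \<subseteq> fibres R I" "card \<U> = w'" and Y: "Y = \<Union>\<U>" for w' \<U> Y
  proof
    let ?P = "\<lambda>j. (1 / real w') *\<^sub>R (restrict_to Y (F j) + restrict_to Y (D j))"
    have split_prim: "primitive_idempotent (restrict_to Y ` \<A>) (?P j)"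
      "primitive_idempotent (restrict_to Y ` \<A>) (restrict_to Y (F j) - ?P j)" if "j < l" for j
    proof -
      have "j \<le> e" using that assms(4) by simp
      moreover have "card \<U> \<ge> 2" using w U(2) by simp
      ultimately show "primitive_idempotent (restrict_to Y ` \<A>) (?P j)"
        "primitive_idempotent (restrict_to Y ` \<A>) (restrict_to Y (F j) - ?P j)"
        using D[OF that] restricted_split_idempotents[OF primB, of j "D j" \<U>] U(1)
        unfolding Q_def Y U(2)[symmetric] by blast+
    qed
    have "\<U> \<noteq> {}" using w U(2) by auto
    then have "primitive_idempotent (restrict_to Y ` \<A>) (restrict_to Y (F j))" if "j \<in> {l..e}" for j
      unfolding Y using that assms(6) by (intro restricted_primitive_idempotent primB U(1)) auto
    then show sup: "?L \<subseteq> ?prim" using split_prim by auto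
    show "?prim \<subseteq> ?L"
    proof (rule subsetI, rule ccontr)
      fix E assume E: "E \<in> ?prim" and "E \<notin> ?L"
      \<comment> \<open>A primitive idempotent outside the list is orthogonal to all of it, hence to
        every restricted \<open>F j\<close> and to their sum, the identity of the restricted
        algebra.\<close>
      then have E0: "E ** P = 0" if "P \<in> ?L" for P
        using that sup by (intro primitive_idempotents_orthogonal[OF restrict_A_symmetric]) auto
      have "E ** restrict_to Y (F j) = 0" if "j \<le> e" for j
      proof (cases "j < l")
        case True
        \<comment> \<open>The two pieces add up to the restriction of \<open>F j\<close>.\<close>
        then have "E ** ?P j = 0" "E ** (restrict_to Y (F j) - ?P j) = 0"
          by (auto intro!: E0)
        then show ?thesis by (simp add: matrix_mult.diff_right)
      next
        case False
        then show ?thesis using that by (auto intro!: E0)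
      qed
      then have "E ** restrict_to Y (\<Sum>j\<le>e. F j) = 0"
        by (simp add: block_sum matrix_mult.sum_right)
      then have "E ** restrict_to Y (mat 1) = 0" unfolding sumF .
      moreover obtain A where "E = restrict_to Y A"
        using E by (auto simp: primitive_idempotent_def)
      ultimately have "E = 0"
        by (simp add: block_mult_block) (simp add: block_def diag_indicator_idem flip: matrix_mul_assoc)
      then show False using E by (simp add: primitive_idempotent_def)
    qed
  qed
  moreover have "\<forall>j<l. D j \<in> \<D>" using D by (auto simp: Q_def)
  ultimately show ?thesis by (intro exI[of _ D]) blast
qed

end
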